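(* Let $\alpha_r,\ \delta_r,\ u_r,\ v_r,\ \delta'_r,\ u'_r,\ v'_r,\ t_r$ and $w_r$ be any functions of $r$ only. If $$\beta_{(n,l)}=\sum_{m=0}^{\min(n,l)}\alpha_m\,u_{n-m}\,u'_{l-m}\,v_{n+m}\,v'_{l+m}\,t_{n-l}\,w_{l+n}$$ and $$\gamma_m=\sum_{n=m}^{\infty}\sum_{l=m}^{\infty}\delta_n\,\delta'_l\,u_{n-m}\,u'_{l-m}\,v_{n+m}\,v'_{l+m}\,t_{n-l}\,w_{l+n},$$ then, subject to convergence conditions, $$\sum_{m=0}^\infty\alpha_m\gamma_m=\sum_{n,l=0}^\infty\beta_{(n,l)}\,\delta_n\,\delta'_l .$$
   Context: Here $n,l,m$ are non-negative integers, and $r$ is an integer index (for $t_r$ the index $r=n-l$ may be negative). The phrase "subject to convergence conditions" is the paper's own; the paper does not specify the conditions further in the statement. Its proof rearranges the series $\sum_{m=0}^\infty\sum_{n=m}^\infty\sum_{l=m}^\infty \alpha_m\,\delta_n\,\delta'_l\,u_{n-m}\,u'_{l-m}\,v_{n+m}\,v'_{l+m}\,t_{n-l}\,w_{l+n}$ under the assumption that this series is convergent. *)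

theory Defs
  imports "HOL-Analysis.Analysis"
begin

text \<open>The ordinary (sequential) series \<open>f m + f (m + 1) + f (m + 2) + \<dots>\<close>;
  like \<^const>\<open>suminf\<close>, it carries information only when the series converges.\<close>

definition series_from :: "nat \<Rightarrow> (nat \<Rightarrow> 'a) \<Rightarrow> 'a::{topological_space, comm_monoid_add}"
  where "series_from m f = (\<Sum>k. f (m + k))"

end

(* Unconditional convergence of the triple series allows it to be summed in any order. Summing over
   (n, l) first, after the shift n = m + i, l = m + j, gives the terms alpha m * gamma m; where
   alpha m is nonzero it can be cancelled, so the double series gamma m converges unconditionally and
   its iterated sum is the unordered one. Summing over m <= min n l first gives
   beta n l * delta n * delta' l. *)
theory Submission
  imports Defs
begin

lemma suminf_eq_infsum:
  fixes f :: "nat \<Rightarrow> 'a::{comm_monoid_add, t2_space}"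
  assumes "f summable_on UNIV"
  shows "(\<Sum>n. f n) = (\<Sum>\<^sub>\<infinity>n. f n)"
  using assms has_sum_imp_sums has_sum_infsum sums_unique by metis

text \<open>The slice at \<open>x\<close> is the restriction of the family to
  \<open>range (Pair x)\<close>; completeness lets unconditional summability pass to
  subsets.\<close>

lemma summable_on_slice_banach:
  fixes f :: "'b \<Rightarrow> 'c \<Rightarrow> 'a::banach"
  assumes "(\<lambda>(x, y). f x y) summable_on UNIV"
  shows "f x summable_on UNIV"
proof -
  have "(\<lambda>(x, y). f x y) summable_on range (Pair x)"
    using assms by (rule summable_on_subset_banach) simp
  then show ?thesis
    by (subst (asm) summable_on_reindex) (auto simp: inj_on_def o_def)
qed

text \<open>Joint summability makes every row and the family of row sums summable, so both
  sequential series become unordered sums and Fubini applies.\<close>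

lemma suminf_suminf_eq_infsum:
  fixes f :: "nat \<Rightarrow> nat \<Rightarrow> 'a::banach"
  assumes "(\<lambda>(i, j). f i j) summable_on UNIV"
  shows "(\<Sum>i. \<Sum>j. f i j) = (\<Sum>\<^sub>\<infinity>(i, j). f i j)"
proof -
  have prod: "(\<lambda>(i, j). f i j) summable_on UNIV \<times> UNIV"
    using assms by simp
  have "(\<Sum>i. \<Sum>j. f i j) = (\<Sum>i. \<Sum>\<^sub>\<infinity>j. f i j)"
    by (simp add: suminf_eq_infsum summable_on_slice_banach [OF assms])
  also have "\<dots> = (\<Sum>\<^sub>\<infinity>i. \<Sum>\<^sub>\<infinity>j. f i j)"
    by (rule suminf_eq_infsum) (rule summable_on_Sigma_banach [OF prod])
  also have "\<dots> = (\<Sum>\<^sub>\<infinity>(i, j). f i j)"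
    using infsum_Sigma'_banach [OF prod] by simp
  finally show ?thesis .
qed

theorem theorem2p1:
  fixes \<alpha> \<delta> u v \<delta>' u' v' w :: "nat \<Rightarrow> 'a::{real_normed_field, banach}"
    and t :: "int \<Rightarrow> 'a"
    and \<beta> :: "nat \<Rightarrow> nat \<Rightarrow> 'a"
    and \<gamma> :: "nat \<Rightarrow> 'a"
  assumes beta: "\<And>n l. \<beta> n l =
      (\<Sum>m = 0..min n l. \<alpha> m * u (n - m) * u' (l - m) * v (n + m) * v' (l + m)
          * t (int n - int l) * w (l + n))"
    and gamma: "\<And>m. \<gamma> m =
      series_from m (\<lambda>n. series_from m (\<lambda>l.
          \<delta> n * \<delta>' l * u (n - m) * u' (l - m) * v (n + m) * v' (l + m)
          * t (int n - int l) * w (l + n)))"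
    and conv: "(\<lambda>(m, n, l). \<alpha> m * \<delta> n * \<delta>' l * u (n - m) * u' (l - m) * v (n + m) * v' (l + m)
          * t (int n - int l) * w (l + n)) summable_on {(m, n, l). m \<le> n \<and> m \<le> l}"
  shows "summable (\<lambda>m. \<alpha> m * \<gamma> m)
    \<and> (\<lambda>(n, l). \<beta> n l * \<delta> n * \<delta>' l) summable_on UNIV
    \<and> (\<Sum>m. \<alpha> m * \<gamma> m) = (\<Sum>\<^sub>\<infinity>(n, l)\<in>UNIV. \<beta> n l * \<delta> n * \<delta>' l)"

proof -
  \<comment> \<open>\<open>K\<close> leaves out \<alpha>, so that \<open>K m\<close> is exactly the
    summand of \<open>\<gamma> m\<close>.\<close>
  define K where "K m n l = \<delta> n * \<delta>' l * u (n - m) * u' (l - m) * v (n + m) * v' (l + m)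
          * t (int n - int l) * w (l + n)" for m n l
  define S where "S = {(m, n, l). m \<le> n \<and> m \<le> (l::nat)}"
  define F where "F = (\<lambda>(m, n, l). \<alpha> m * K m n l)"
  have F: "F summable_on S"
    using conv by (simp add: F_def S_def K_def mult.assoc)

  \<comment> \<open>The shift turns \<open>S\<close> into a full product and matches the indexing
    \<open>m + k\<close> in \<open>series_from\<close>.\<close>
  define G where "G = (\<lambda>(m, i, j). \<alpha> m * K m (m + i) (m + j))"
  have G: "G summable_on UNIV \<times> UNIV" and infsum_G: "infsum G UNIV = infsum F S"
  proof -
    \<comment> \<open>Subtraction inverts the shift, as nothing is truncated on
      \<open>S\<close>.\<close>
    have bij: "bij_betw (\<lambda>(m, i, j). (m, m + i, m + j)) UNIV S"
      by (rule bij_betw_byWitness [where f' = "\<lambda>(m, n, l). (m, n - m, l - m)"])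
        (auto simp: S_def)
    have G_eq: "G = (\<lambda>x. F ((\<lambda>(m, i, j). (m, m + i, m + j)) x))"
      by (auto simp: G_def F_def)
    show "G summable_on UNIV \<times> UNIV"
      using F summable_on_reindex_bij_betw [OF bij, of F] by (simp add: G_eq)
    show "infsum G UNIV = infsum F S"
      using infsum_reindex_bij_betw [OF bij, of F] by (simp add: G_eq)
  qed
  have G_slice: "(\<lambda>p. G (m, p)) summable_on UNIV" for m
    using G summable_on_slice_banach [of "\<lambda>m p. G (m, p)"] by simp
  have alpha_gamma: "\<alpha> m * \<gamma> m = (\<Sum>\<^sub>\<infinity>p. G (m, p))" for m
  \<comment> \<open>If \<open>\<alpha> m = 0\<close>, the hypothesis says nothing about convergence
    of the series for \<open>\<gamma> m\<close>, but both sides vanish whatever value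
    \<open>\<gamma> m\<close> has.\<close>
  proof (cases "\<alpha> m = 0")
    case True
    then show ?thesis
      by (simp add: G_def case_prod_unfold)
  next
    case False
    then have "(\<lambda>(i, j). K m (m + i) (m + j)) summable_on UNIV"
      using G_slice [of m] summable_on_cmult_right' [OF False, of "\<lambda>(i, j). K m (m + i) (m + j)"]
      by (simp add: G_def case_prod_unfold)
    then have "\<gamma> m = (\<Sum>\<^sub>\<infinity>(i, j). K m (m + i) (m + j))"
      unfolding gamma series_from_def K_def [symmetric] by (rule suminf_suminf_eq_infsum)
    then show ?thesis
      by (simp add: G_def case_prod_unfold infsum_cmult_right')
  qed
  have sum_m: "(\<lambda>m. \<alpha> m * \<gamma> m) summable_on UNIV"
    using summable_on_Sigma_banach [of "\<lambda>m p. G (m, p)" UNIV "\<lambda>_. UNIV"] G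
    by (simp add: alpha_gamma)
  have infsum_m: "(\<Sum>\<^sub>\<infinity>m. \<alpha> m * \<gamma> m) = infsum F S"
    using infsum_Sigma_banach [OF G] by (simp add: alpha_gamma infsum_G)

  \<comment> \<open>\<open>T\<close> is \<open>S\<close> regrouped with \<open>(n, l)\<close>
    outermost: \<open>m\<close> is at most both \<open>n\<close> and \<open>l\<close> iff it is at
    most \<open>min n l\<close>.\<close>
  define T where "T = (SIGMA (n, l) : UNIV. {0..min n (l::nat)})"
  define H where "H = (\<lambda>(n, l) m. F (m, n, l))"
  have bij: "bij_betw (\<lambda>((n, l), m). (m, n, l)) T S"
    by (rule bij_betw_byWitness [where f' = "\<lambda>(m, n, l). ((n, l), m)"])
      (auto simp: S_def T_def)
  have H_eq: "(\<lambda>(p, m). H p m) = (\<lambda>x. F ((\<lambda>((n, l), m). (m, n, l)) x))"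
    by (auto simp: H_def)
  have H: "(\<lambda>(p, m). H p m) summable_on T"
    using F summable_on_reindex_bij_betw [OF bij, of F] by (simp add: H_eq)
  have infsum_H: "(\<Sum>\<^sub>\<infinity>(p, m)\<in>T. H p m) = infsum F S"
    using infsum_reindex_bij_betw [OF bij, of F] by (simp add: H_eq)
  \<comment> \<open>The fibre over \<open>(n, l)\<close> is finite, so its sum is an ordinary one,
    from which the factors \<open>\<delta> n\<close> and \<open>\<delta>' l\<close>, free of
    \<open>m\<close>, come out.\<close>
  have beta_eq: "(\<Sum>\<^sub>\<infinity>m\<in>(case p of (n, l) \<Rightarrow> {0..min n l}). H p m) =
      (case p of (n, l) \<Rightarrow> \<beta> n l * \<delta> n * \<delta>' l)" for p
    by (cases p) (auto simp: H_def F_def K_def beta sum_distrib_left mult_ac intro!: sum.cong)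
  have sum_nl: "(\<lambda>(n, l). \<beta> n l * \<delta> n * \<delta>' l) summable_on UNIV"
    using summable_on_Sigma_banach [OF H [unfolded T_def]] by (simp only: beta_eq)
  have infsum_nl: "(\<Sum>\<^sub>\<infinity>(n, l)\<in>UNIV. \<beta> n l * \<delta> n * \<delta>' l) = infsum F S"
    using infsum_Sigma'_banach [OF H [unfolded T_def]] infsum_H
    by (simp only: beta_eq T_def)

  show ?thesis
    using sum_m sum_nl infsum_m infsum_nl
    by (simp add: summable_on_imp_summable suminf_eq_infsum)
qed

end
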